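(* Let $k\ge 1$ be an integer, let $X_k=Y_k=[0,\infty)\times\{0,\ldots,k\}\subseteq\mathbb{R}^2$, and let $f_k\colon X_k\to X_k$ and $g_k\colon Y_k\to Y_k$ be the bijective maps $$g_k(r,j)=\bigl(2^{\min(j,1)}r,\ (j-1)\bmod (k+1)\bigr),$$ $$f_k(r,j)=\begin{cases}\bigl(2^{\min(j,1)}r,\ (j-1)\bmod k\bigr)&\text{if } j\le k-1,\\ (2r,\ j)&\text{if } j=k.\end{cases}$$ Then: (1) for all $n\in\{1,\ldots,k\}$ the maps $f_k^n$ and $g_k^n$ are coarsely conjugate via the identity maps (i.e. with $\varphi=\psi=\mathrm{id}$); (2) there is no coarse equivalence $\varphi\colon X_k\to Y_k$ such that $\varphi\circ f_k^{k+1}$ and $g_k^{k+1}\circ\varphi$ are close; in particular, $f_k^{k+1}$ and $g_k^{k+1}$ are not coarsely conjugate.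
   Context: Subsets of $\mathbb{R}^2$ carry the metric induced by a norm (the choice is irrelevant; e.g. the maximum norm). For integers $a$ and $m\ge1$, $a\bmod m$ is the residue in $\{0,\ldots,m-1\}$. $f^n$ denotes the $n$-fold iterate. Let $(X,d_X)$ and $(Y,d_Y)$ be metric spaces. Two maps $a,b$ from a set $S$ to $Y$ are close if $\sup_{x\in S} d_Y(a(x),b(x))<\infty$. A map $\varphi\colon X\to Y$ is controlled if there exists a non-decreasing function $\rho\colon[0,\infty)\to[0,\infty)$ such that $d_Y(\varphi(x),\varphi(x'))\le\rho(d_X(x,x'))$ for all $x,x'\in X$. A controlled map $\varphi\colon X\to Y$ is a coarse equivalence if it admits a coarse inverse, that is, a controlled map $\psi\colon Y\to X$ such that $\varphi\circ\psi$ and $\psi\circ\varphi$ are close to the respective identity maps. Maps $f\colon X\to X$ and $g\colon Y\to Y$ are coarsely conjugate (via $\varphi$ and $\psi$) if there exists a coarse equivalence $\varphi\colon X\to Y$ with a coarse inverse $\psi\colon Y\to X$ such that $\varphi\circ f$ is close to $g\circ\varphi$ and $\psi\circ g$ is close to $f\circ\psi$. *)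

theory Defs
  imports "HOL-Analysis.Analysis"
begin

definition close_maps :: "'s set \<Rightarrow> 'b metric \<Rightarrow> ('s \<Rightarrow> 'b) \<Rightarrow> ('s \<Rightarrow> 'b) \<Rightarrow> bool" where
  "close_maps S Y a b \<longleftrightarrow> bdd_above ((\<lambda>x. mdist Y (a x) (b x)) ` S)"

definition controlled :: "'a metric \<Rightarrow> 'b metric \<Rightarrow> ('a \<Rightarrow> 'b) \<Rightarrow> bool" where
  "controlled X Y \<phi> \<longleftrightarrow>
     \<phi> \<in> mspace X \<rightarrow> mspace Y \<and>
     (\<exists>\<rho> \<in> {0::real..} \<rightarrow> {0::real..}. mono_on {0..} \<rho> \<and>
        (\<forall>x\<in>mspace X. \<forall>x'\<in>mspace X. mdist Y (\<phi> x) (\<phi> x') \<le> \<rho> (mdist X x x')))"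

definition coarse_inverse :: "'a metric \<Rightarrow> 'b metric \<Rightarrow> ('a \<Rightarrow> 'b) \<Rightarrow> ('b \<Rightarrow> 'a) \<Rightarrow> bool" where
  "coarse_inverse X Y \<phi> \<psi> \<longleftrightarrow>
     controlled Y X \<psi> \<and>
     close_maps (mspace Y) Y (\<phi> \<circ> \<psi>) id \<and>
     close_maps (mspace X) X (\<psi> \<circ> \<phi>) id"

definition coarse_equivalence :: "'a metric \<Rightarrow> 'b metric \<Rightarrow> ('a \<Rightarrow> 'b) \<Rightarrow> bool" where
  "coarse_equivalence X Y \<phi> \<longleftrightarrow> controlled X Y \<phi> \<and> (\<exists>\<psi>. coarse_inverse X Y \<phi> \<psi>)"

text \<open>The maps \<open>f\<close> and \<open>g\<close> are understood to be self-maps of \<open>mspace X\<close> and \<open>mspace Y\<close>.\<close>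

definition coarsely_conjugate_via ::
  "'a metric \<Rightarrow> 'b metric \<Rightarrow> ('a \<Rightarrow> 'a) \<Rightarrow> ('b \<Rightarrow> 'b) \<Rightarrow> ('a \<Rightarrow> 'b) \<Rightarrow> ('b \<Rightarrow> 'a) \<Rightarrow> bool" where
  "coarsely_conjugate_via X Y f g \<phi> \<psi> \<longleftrightarrow>
     coarse_equivalence X Y \<phi> \<and> coarse_inverse X Y \<phi> \<psi> \<and>
     close_maps (mspace X) Y (\<phi> \<circ> f) (g \<circ> \<phi>) \<and>
     close_maps (mspace Y) X (\<psi> \<circ> g) (f \<circ> \<psi>)"

definition coarsely_conjugate ::
  "'a metric \<Rightarrow> 'b metric \<Rightarrow> ('a \<Rightarrow> 'a) \<Rightarrow> ('b \<Rightarrow> 'b) \<Rightarrow> bool" where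
  "coarsely_conjugate X Y f g \<longleftrightarrow> (\<exists>\<phi> \<psi>. coarsely_conjugate_via X Y f g \<phi> \<psi>)"

definition is_norm :: "('v::real_vector \<Rightarrow> real) \<Rightarrow> bool" where
  "is_norm N \<longleftrightarrow>
     (\<forall>x. N x = 0 \<longleftrightarrow> x = 0) \<and>
     (\<forall>c x. N (c *\<^sub>R x) = \<bar>c\<bar> * N x) \<and>
     (\<forall>x y. N (x + y) \<le> N x + N y)"

text \<open>Meaningful only if \<open>is_norm N\<close> holds; see \<open>mspace_norm_metric\<close> and \<open>mdist_norm_metric\<close> below.\<close>

definition norm_metric :: "('v::real_vector \<Rightarrow> real) \<Rightarrow> 'v set \<Rightarrow> 'v metric" where
  "norm_metric N S = metric (S, \<lambda>x y. N (x - y))"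

definition strips :: "nat \<Rightarrow> (real \<times> real) set" where
  "strips k = {0..} \<times> real ` {0..k}"

text \<open>
  The second coordinate of a point of the plane is a real number, whereas the residue is taken
  of an integer; on \<open>strips k\<close> the second coordinate is an integer, so the floor only
  changes its type.
\<close>

definition g_map :: "nat \<Rightarrow> real \<times> real \<Rightarrow> real \<times> real" where
  "g_map k = (\<lambda>(r, t). let j = \<lfloor>t\<rfloor> in
     (2 powi (min j 1) * r, of_int ((j - 1) mod (int k + 1))))"

definition f_map :: "nat \<Rightarrow> real \<times> real \<Rightarrow> real \<times> real" where
  "f_map k = (\<lambda>(r, t). let j = \<lfloor>t\<rfloor> in
     if j \<le> int k - 1 then (2 powi (min j 1) * r, of_int ((j - 1) mod int k))
     else (2 * r, of_int j))"

lemma Metric_space_norm: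
  fixes N :: "'v::real_vector \<Rightarrow> real"
  assumes "is_norm N"
  shows "Metric_space S (\<lambda>x y. N (x - y))"
proof -
  have zero: "N x = 0 \<longleftrightarrow> x = 0" and scale: "N (c *\<^sub>R x) = \<bar>c\<bar> * N x"
    and tri: "N (x + y) \<le> N x + N y" for c x y
    using assms by (auto simp: is_norm_def)
  have minus: "N (- x) = N x" for x
    using scale[of "-1" x] by simp
  have nonneg: "0 \<le> N x" for x
    using tri[of x "- x"] minus[of x] zero[of 0] by simp
  show ?thesis
  proof
    fix x y z
    show "0 \<le> N (x - y)" by (rule nonneg)
    show "N (x - y) = N (y - x)" using minus[of "x - y"] by simp
    show "N (x - y) = 0 \<longleftrightarrow> x = y" using zero[of "x - y"] by simp
    show "N (x - z) \<le> N (x - y) + N (y - z)" using tri[of "x - y" "y - z"] by simp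
  qed
qed

lemma mspace_norm_metric [simp]: "is_norm N \<Longrightarrow> mspace (norm_metric N S) = S"
  by (simp add: norm_metric_def Metric_space_norm Metric_space.mspace_metric)

lemma mdist_norm_metric [simp]: "is_norm N \<Longrightarrow> mdist (norm_metric N S) = (\<lambda>x y. N (x - y))"
  by (simp add: norm_metric_def Metric_space_norm Metric_space.mdist_metric)

lemma g_map_of_nat:
  "g_map k (r, real j) = (2 ^ min j 1 * r, of_int ((int j - 1) mod (int k + 1)))"
  by (cases j) (auto simp: g_map_def)

lemma f_map_of_nat:
  "j < k \<Longrightarrow> f_map k (r, real j) = (2 ^ min j 1 * r, of_int ((int j - 1) mod int k))"
  "f_map k (r, real k) = (2 * r, real k)"
  by (cases j; auto simp: f_map_def)+

end

theory Submission
  imports Defs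
begin

text \<open>
  At the times less than \<open>k\<close>, the orbit of a point under either map meets the level \<open>0\<close>, the only
  one on which the first coordinate is not doubled, at most once, and at the same time for both
  maps. Hence
  \<open>f_map k ^^ n\<close> and \<open>g_map k ^^ n\<close> have the same first coordinate for \<open>n \<le> k\<close>
  (\<open>fst_f_map_funpow_eq\<close>), and since the second coordinates are bounded, the two iterates are close.

  The iterate \<open>g_map k ^^ (k + 1)\<close> multiplies the first coordinate by \<open>2 ^ k\<close> on every strip,
  whereas \<open>f_map k ^^ (k + 1)\<close> multiplies it by \<open>2 ^ (k + 1)\<close> on the top strip. Suppose that
  \<open>\<phi>\<close> intertwines these iterates up to a bounded error, and put
  \<open>p n = (2 ^ ((k + 1) * n), k)\<close>, an orbit of \<open>f_map k ^^ (k + 1)\<close>. The norms of \<open>\<phi> (p n)\<close>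
  then grow at most like \<open>2 ^ (k * n)\<close>. A coarse inverse \<open>\<psi>\<close> of \<open>\<phi>\<close>, being controlled on a
  space whose points are joined by chains of bounded steps, grows at most affinely
  (\<open>controlled_strips_affine_bound\<close>), so the norms of \<open>\<psi> (\<phi> (p n))\<close> also grow at most like
  \<open>2 ^ (k * n)\<close>. But these points stay at bounded distance from \<open>p n\<close>, whose norms grow like
  \<open>2 ^ ((k + 1) * n)\<close>, a contradiction. The equivalence of norms on the plane is
  not needed: since second coordinates are bounded, \<open>is_norm_ge_fst\<close> bounds the norm on the strips
  from below by a multiple of the first coordinate, up to an additive constant.
\<close>

section \<open>Norms on the plane\<close>

lemma is_norm_zero: "is_norm N \<Longrightarrow> N 0 = 0"
  by (simp add: is_norm_def)

lemma is_norm_scale: "is_norm N \<Longrightarrow> N (c *\<^sub>R x) = \<bar>c\<bar> * N x"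
  by (simp add: is_norm_def)

lemma is_norm_triangle: "is_norm N \<Longrightarrow> N (x + y) \<le> N x + N y"
  by (simp add: is_norm_def)

lemma is_norm_minus: "is_norm N \<Longrightarrow> N (- x) = N x"
  using is_norm_scale[of N "-1" x] by simp

lemma is_norm_nonneg: "is_norm N \<Longrightarrow> 0 \<le> N x"
  using is_norm_triangle[of N x "- x"] is_norm_minus[of N x] is_norm_zero[of N] by simp

lemma is_norm_triangle_sub: "is_norm N \<Longrightarrow> N x \<le> N y + N (x - y)"
  using is_norm_triangle[of N y "x - y"] by simp

lemma is_norm_diff_commute: "is_norm N \<Longrightarrow> N (x - y) = N (y - x)"
  using is_norm_minus[of N "x - y"] by simp

lemma is_norm_fst_axis: "is_norm N \<Longrightarrow> N (x, 0) = \<bar>x\<bar> * N (1, 0)"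
  for N :: "real \<times> real \<Rightarrow> real"
  using is_norm_scale[of N x "(1, 0)"] by simp

lemma is_norm_snd_axis: "is_norm N \<Longrightarrow> N (0, y) = \<bar>y\<bar> * N (0, 1)"
  for N :: "real \<times> real \<Rightarrow> real"
  using is_norm_scale[of N y "(0, 1)"] by simp

lemma is_norm_fst_pos: "is_norm N \<Longrightarrow> 0 < N (1, 0)"
  for N :: "real \<times> real \<Rightarrow> real"
proof -
  assume N: "is_norm N"
  have "N (1, 0) \<noteq> 0" using N by (auto simp: is_norm_def zero_prod_def)
  with is_norm_nonneg[OF N, of "(1, 0)"] show ?thesis by linarith
qed

lemma is_norm_ge_fst: "is_norm N \<Longrightarrow> \<bar>x\<bar> * N (1, 0) \<le> N (x, y) + \<bar>y\<bar> * N (0, 1)"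
  for N :: "real \<times> real \<Rightarrow> real"
  using is_norm_triangle_sub[of N "(x, 0)" "(x, y)"] is_norm_fst_axis[of N x]
    is_norm_snd_axis[of N "- y"] by simp


section \<open>The maps and their iterates\<close>

lemma strips_iff: "(r, t) \<in> strips k \<longleftrightarrow> 0 \<le> r \<and> (\<exists>j\<le>k. t = real j)"
  by (auto simp: strips_def)

lemma strips_cases:
  assumes "x \<in> strips k"
  obtains r j where "x = (r, real j)" "0 \<le> r" "j \<le> k"
  using assms by (cases x) (auto simp: strips_iff)

lemma g_map_0: "g_map k (r, 0) = (r, real k)"
  using g_map_of_nat[of k r 0] by (simp add: zmod_minus1)

lemma g_map_Suc: "j < k \<Longrightarrow> g_map k (r, real (Suc j)) = (2 * r, real j)"
  by (simp only: g_map_of_nat) simp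

lemma f_map_0: "1 \<le> k \<Longrightarrow> f_map k (r, 0) = (r, real (k - 1))"
  using f_map_of_nat(1)[of 0 k r] by (simp add: zmod_minus1 of_nat_diff)

lemma f_map_Suc: "Suc j < k \<Longrightarrow> f_map k (r, real (Suc j)) = (2 * r, real j)"
  by (simp only: f_map_of_nat) simp

lemma bij_betw_g_map: "bij_betw (g_map k) (strips k) (strips k)"
proof (rule bij_betw_byWitness)
  define h where "h = (\<lambda>(r::real, t). if t = real k then (r, 0::real) else (r / 2, t + 1))"
  have g: "g_map k x \<in> strips k \<and> h (g_map k x) = x" if "x \<in> strips k" for x
    using that
  proof (cases rule: strips_cases)
    case (1 r j)
    show ?thesis
    proof (cases j)
      case 0
      then show ?thesis using 1 by (auto simp: g_map_0 h_def strips_iff)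
    next
      case (Suc i)
      then have "g_map k x = (2 * r, real i)" using 1 by (simp only: g_map_Suc)
      then show ?thesis using 1 Suc by (auto simp: h_def strips_iff)
    qed
  qed
  have h: "h x \<in> strips k \<and> g_map k (h x) = x" if "x \<in> strips k" for x
    using that
  proof (cases rule: strips_cases)
    case (1 r j)
    show ?thesis
    proof (cases "j = k")
      case True
      have "(r, 0) \<in> strips k" using 1 strips_iff[of r 0 k] by force
      with True 1 show ?thesis by (simp add: h_def g_map_0)
    next
      case False
      then have "h x = (r / 2, real (Suc j))" "j < k" using 1 by (auto simp: h_def)
      then show ?thesis using 1 by (auto simp: g_map_Suc strips_iff simp del: of_nat_Suc)
    qed
  qed
  show "\<forall>x\<in>strips k. h (g_map k x) = x" "\<forall>x\<in>strips k. g_map k (h x) = x"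
    "g_map k ` strips k \<subseteq> strips k" "h ` strips k \<subseteq> strips k"
    using g h by auto
qed

lemma bij_betw_f_map:
  assumes "1 \<le> k"
  shows "bij_betw (f_map k) (strips k) (strips k)"
proof (rule bij_betw_byWitness)
  define h where "h = (\<lambda>(r::real, t). if t = real k then (r / 2, t)
    else if t = real (k - 1) then (r, 0::real) else (r / 2, t + 1))"
  have f: "f_map k x \<in> strips k \<and> h (f_map k x) = x" if "x \<in> strips k" for x
    using that
  proof (cases rule: strips_cases)
    case (1 r j)
    consider "j = k" | "j = 0" "j < k" | i where "j = Suc i" "Suc i < k"
      using 1 assms by (cases j) (auto simp: le_less)
    then show ?thesis
    proof cases
      case 1
      then show ?thesis using \<open>x = _\<close> \<open>0 \<le> r\<close> by (auto simp: f_map_of_nat h_def strips_iff)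
    next
      case 2
      have "(r, real (k - 1)) \<in> strips k"
        using \<open>0 \<le> r\<close> by (auto simp: strips_iff simp del: of_nat_diff)
      with 2 show ?thesis using \<open>x = _\<close> assms by (auto simp: f_map_0 h_def)
    next
      case 3
      then have "f_map k x = (2 * r, real i)" using \<open>x = _\<close> by (simp only: f_map_Suc)
      then show ?thesis using 3 \<open>x = _\<close> \<open>0 \<le> r\<close>
        by (auto simp: h_def strips_iff)
    qed
  qed
  have h: "h x \<in> strips k \<and> f_map k (h x) = x" if "x \<in> strips k" for x
    using that
  proof (cases rule: strips_cases)
    case (1 r j)
    consider "j = k" | "j = k - 1" "j \<noteq> k" | "Suc j < k"
      using 1 by linarith
    then show ?thesis
    proof cases
      case 1
      then show ?thesis using \<open>x = _\<close> \<open>0 \<le> r\<close> by (auto simp: f_map_of_nat h_def strips_iff)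
    next
      case 2
      have "(r, 0) \<in> strips k" using \<open>0 \<le> r\<close> strips_iff[of r 0 k] by force
      with 2 show ?thesis using \<open>x = _\<close> assms by (auto simp: f_map_0 h_def)
    next
      case 3
      then have "h x = (r / 2, real (Suc j))" using \<open>x = _\<close> by (auto simp: h_def)
      then show ?thesis using 3 \<open>0 \<le> r\<close> \<open>x = _\<close>
        by (auto simp: f_map_Suc strips_iff simp del: of_nat_Suc)
    qed
  qed
  show "\<forall>x\<in>strips k. h (f_map k x) = x" "\<forall>x\<in>strips k. f_map k (h x) = x"
    "f_map k ` strips k \<subseteq> strips k" "h ` strips k \<subseteq> strips k"
    using f h by auto
qed

lemma g_map_funpow_le:
  "n \<le> j \<Longrightarrow> j \<le> k \<Longrightarrow> (g_map k ^^ n) (r, real j) = (2 ^ n * r, real (j - n))"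
proof (induction n)
  case (Suc n)
  then have "j - n = Suc (j - Suc n)" "j - Suc n < k" by auto
  with Suc show ?case by (simp add: g_map_Suc del: of_nat_Suc)
qed simp

lemma f_map_funpow_le:
  "n \<le> j \<Longrightarrow> j < k \<Longrightarrow> (f_map k ^^ n) (r, real j) = (2 ^ n * r, real (j - n))"
proof (induction n)
  case (Suc n)
  then have "j - n = Suc (j - Suc n)" "Suc (j - Suc n) < k" by auto
  with Suc show ?case by (simp add: f_map_Suc del: of_nat_Suc)
qed simp

lemma f_map_funpow_top: "(f_map k ^^ n) (r, real k) = (2 ^ n * r, real k)"
  by (induction n) (auto simp: f_map_of_nat)

text \<open>
  The orbit of level \<open>j\<close> under \<open>g_map k\<close> meets level \<open>0\<close> at the times \<open>j\<close>, \<open>j + (k + 1)\<close>, and so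
  on; under \<open>f_map k\<close>, for \<open>j < k\<close>, at the times \<open>j\<close>, \<open>j + k\<close>, and so on. The bounds on \<open>n\<close> in the
  next two lemmas ensure that only the first of these times is less than \<open>n\<close>, which costs
  exactly one doubling.
\<close>

lemma g_map_funpow_gt:
  assumes "j < n" "n \<le> Suc k" "j \<le> k"
  shows "(g_map k ^^ n) (r, real j) = (2 ^ (n - 1) * r, real (k + 1 + j - n))"
proof -
  have n: "n = (n - j - 1) + (1 + j)" using assms by simp
  have "(g_map k ^^ n) (r, real j) = (g_map k ^^ (n - j - 1)) (g_map k ((g_map k ^^ j) (r, real j)))"
    by (subst n, simp only: funpow_add) simp
  also have "\<dots> = (g_map k ^^ (n - j - 1)) (2 ^ j * r, real k)"
    using assms by (simp add: g_map_funpow_le g_map_0)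
  also have "\<dots> = (2 ^ (n - j - 1) * (2 ^ j * r), real (k - (n - j - 1)))"
    using assms by (intro g_map_funpow_le) auto
  also have "2 ^ (n - j - 1) * (2 ^ j * r) = 2 ^ (n - 1) * r"
    using assms by (simp flip: mult.assoc power_add)
  also have "k - (n - j - 1) = k + 1 + j - n" using assms by simp
  finally show ?thesis .
qed

lemma f_map_funpow_gt:
  assumes "j < n" "n \<le> k"
  shows "(f_map k ^^ n) (r, real j) = (2 ^ (n - 1) * r, real (k + j - n))"
proof -
  have n: "n = (n - j - 1) + (1 + j)" using assms by simp
  have "(f_map k ^^ n) (r, real j) = (f_map k ^^ (n - j - 1)) (f_map k ((f_map k ^^ j) (r, real j)))"
    by (subst n, simp only: funpow_add) simp
  also have "\<dots> = (f_map k ^^ (n - j - 1)) (2 ^ j * r, real (k - 1))"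
    using assms by (simp add: f_map_funpow_le f_map_0)
  also have "\<dots> = (2 ^ (n - j - 1) * (2 ^ j * r), real (k - 1 - (n - j - 1)))"
    using assms by (intro f_map_funpow_le) auto
  also have "2 ^ (n - j - 1) * (2 ^ j * r) = 2 ^ (n - 1) * r"
    using assms by (simp flip: mult.assoc power_add)
  also have "k - 1 - (n - j - 1) = k + j - n" using assms by simp
  finally show ?thesis .
qed

lemma fst_f_map_funpow_eq:
  assumes "n \<le> k" "x \<in> strips k"
  shows "fst ((f_map k ^^ n) x) = fst ((g_map k ^^ n) x)"
  using assms(2)
proof (cases rule: strips_cases)
  case (1 r j)
  consider "j = k" | "j < n" "j < k" | "n \<le> j" "j < k" using 1 by linarith
  then show ?thesis
    by cases (use 1 assms in \<open>simp_all add: f_map_funpow_top f_map_funpow_gt f_map_funpow_le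
      g_map_funpow_gt g_map_funpow_le\<close>)
qed

lemma g_map_funpow_Suc_k:
  assumes "x \<in> strips k"
  shows "(g_map k ^^ (k + 1)) x = (2 ^ k * fst x, snd x)"
  using assms
proof (cases rule: strips_cases)
  case (1 r j)
  then show ?thesis using g_map_funpow_gt[of j "k + 1" k r] by (simp del: funpow.simps)
qed

lemma f_map_funpow_in_strips: "1 \<le> k \<Longrightarrow> x \<in> strips k \<Longrightarrow> (f_map k ^^ n) x \<in> strips k"
  using bij_betw_f_map[of k] by (induction n) (auto dest: bij_betwE)

lemma g_map_funpow_in_strips: "x \<in> strips k \<Longrightarrow> (g_map k ^^ n) x \<in> strips k"
  using bij_betw_g_map[of k] by (induction n) (auto dest: bij_betwE)


section \<open>Coarse geometry of the strips\<close>

lemma coarse_inverse_id: "coarse_inverse X X id id"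
  by (auto simp: coarse_inverse_def close_maps_def controlled_def mono_on_def
      intro!: bexI[of _ "\<lambda>t. t"] bdd_aboveI[of _ 0]
      simp: Metric_space.mdist_zero[OF Metric_space_mspace_mdist])

lemma coarse_equivalence_id: "coarse_equivalence X X id"
  using coarse_inverse_id[of X]
  by (auto simp: coarse_equivalence_def coarse_inverse_def)

lemma strips_dist_le_of_fst_eq:
  assumes N: "is_norm N" and "x \<in> strips k" "y \<in> strips k" "fst x = fst y"
  shows "N (x - y) \<le> real k * N (0, 1)"
proof -
  have "x - y = (0, snd x - snd y)" using assms by (simp add: prod_eq_iff)
  then have "N (x - y) = \<bar>snd x - snd y\<bar> * N (0, 1)"
    using is_norm_snd_axis[OF N, of "snd x - snd y"] by simp
  also have "\<dots> \<le> real k * N (0, 1)"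
    using assms is_norm_nonneg[OF N, of "(0, 1)"]
    by (intro mult_right_mono) (auto elim!: strips_cases)
  finally show ?thesis .
qed

text \<open>
  Every point of the strips is joined to the origin by a chain of steps of length at most
  \<open>N (1, 0) + k * N (0, 1)\<close>, the number of which is affine in the norm; hence a controlled map
  has at most affine growth.
\<close>

lemma controlled_strips_affine_bound:
  fixes N :: "real \<times> real \<Rightarrow> real"
  assumes N: "is_norm N" and ctrl: "controlled (norm_metric N (strips k)) (norm_metric N S) \<psi>"
  obtains A B where "0 \<le> A" "0 \<le> B" "\<And>y. y \<in> strips k \<Longrightarrow> N (\<psi> y) \<le> A * N y + B"
proof -
  define a b where "a = N (1, 0)" and "b = N (0, 1)"
  have a: "0 < a" and b: "0 \<le> b"
    using is_norm_fst_pos[OF N] is_norm_nonneg[OF N] by (auto simp: a_def b_def)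
  obtain \<rho> where \<rho>: "\<rho> \<in> {0::real..} \<rightarrow> {0::real..}" "mono_on {0..} \<rho>"
    "\<And>x x'. x \<in> strips k \<Longrightarrow> x' \<in> strips k \<Longrightarrow> N (\<psi> x - \<psi> x') \<le> \<rho> (N (x - x'))"
    using ctrl N unfolding controlled_def
    by (simp only: mspace_norm_metric mdist_norm_metric) blast
  define D where "D = \<rho> (a + real k * b)"
  have D: "0 \<le> D" using \<rho>(1) a b by (auto simp: D_def Pi_iff)
  have step: "N (\<psi> x - \<psi> x') \<le> D"
    if "x \<in> strips k" "x' \<in> strips k" "N (x - x') \<le> a + real k * b" for x x'
  proof -
    have "\<rho> (N (x - x')) \<le> D"
      unfolding D_def using that a b is_norm_nonneg[OF N, of "x - x'"]
      by (intro mono_onD[OF \<rho>(2)]) auto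
    with \<rho>(3)[OF that(1,2)] show ?thesis by linarith
  qed
  have zero: "(0, 0) \<in> strips k" using strips_iff[of 0 0 k] by force
  have chain: "N (\<psi> (r, t)) \<le> N (\<psi> (0, 0)) + (real n + 1) * D"
    if "(r, t) \<in> strips k" "r \<le> real n" for r t n
    using that
  proof (induction n arbitrary: r)
    case 0
    then have "r = 0" by (auto simp: strips_iff)
    then have "N ((r, t) - (0, 0)) \<le> real k * b"
      using strips_dist_le_of_fst_eq[OF N 0(1) zero] by (simp add: b_def)
    then have "N (\<psi> (r, t) - \<psi> (0, 0)) \<le> D"
      using a by (intro step 0 zero) linarith
    then show ?case using is_norm_triangle_sub[OF N, of "\<psi> (r, t)" "\<psi> (0, 0)"] by simp
  next
    case (Suc n)
    define s where "s = max 0 (r - 1)"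
    have s: "(s, t) \<in> strips k" "s \<le> real n"
      using Suc.prems by (auto simp: strips_iff s_def)
    have "\<bar>r - s\<bar> \<le> 1" using Suc.prems by (auto simp: strips_iff s_def)
    then have "N ((r, t) - (s, t)) \<le> 1 * a"
      using a is_norm_fst_axis[OF N, of "r - s"] by (simp add: a_def)
    then have "N (\<psi> (r, t) - \<psi> (s, t)) \<le> D"
      using b by (intro step Suc.prems s) (simp add: add_increasing2)
    then show ?case
      using is_norm_triangle_sub[OF N, of "\<psi> (r, t)" "\<psi> (s, t)"] Suc.IH[OF s]
      by (simp add: algebra_simps)
  qed
  show thesis
  proof
    show "0 \<le> D / a" using a D by simp
    show "0 \<le> N (\<psi> (0, 0)) + (real k * b / a + 2) * D"
      using a b D is_norm_nonneg[OF N] by simp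
    fix y assume y: "y \<in> strips k"
    then show "N (\<psi> y) \<le> D / a * N y + (N (\<psi> (0, 0)) + (real k * b / a + 2) * D)"
    proof (cases rule: strips_cases)
      case (1 r j)
      have "r * a \<le> N y + real k * b"
        using is_norm_ge_fst[OF N, of r "real j"] 1 mult_right_mono[of "real j" "real k" b] b
        by (simp add: a_def b_def)
      then have r: "r \<le> (N y + real k * b) / a" using a by (simp add: pos_le_divide_eq)
      have "N (\<psi> y) \<le> N (\<psi> (0, 0)) + (real (nat \<lceil>r\<rceil>) + 1) * D"
        using chain[of r "real j" "nat \<lceil>r\<rceil>"] 1 y by (simp add: real_nat_ceiling_ge)
      also have "\<dots> \<le> N (\<psi> (0, 0)) + ((N y + real k * b) / a + 2) * D"
        using r D 1 by (intro add_left_mono mult_right_mono) linarith+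
      finally show ?thesis by (simp add: add_divide_distrib algebra_simps)
    qed
  qed
qed

section \<open>Comparison of the iterates\<close>

lemma f_map_g_map_funpow_close:
  assumes "1 \<le> k" and N: "is_norm N" and n: "n \<le> k" and X: "X = norm_metric N (strips k)"
  shows "close_maps (mspace X) X (f_map k ^^ n) (g_map k ^^ n)"
  unfolding close_maps_def using assms
  by (auto intro!: bdd_aboveI[of _ "real k * N (0, 1)"] strips_dist_le_of_fst_eq
      f_map_funpow_in_strips g_map_funpow_in_strips fst_f_map_funpow_eq)

lemma close_maps_sym: "close_maps S X p q \<Longrightarrow> close_maps S X q p"
  by (simp add: close_maps_def mdist_commute)

lemma coarsely_conjugate_via_id:
  assumes "1 \<le> k" "is_norm N" "n \<le> k" and X: "X = norm_metric N (strips k)"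
  shows "coarsely_conjugate_via X X (f_map k ^^ n) (g_map k ^^ n) id id"
  using f_map_g_map_funpow_close[OF assms] close_maps_sym
  by (auto simp: coarsely_conjugate_via_def coarse_inverse_id coarse_equivalence_id)

lemma no_coarse_equivalence:
  assumes k: "1 \<le> k" and N: "is_norm N" and X: "X = norm_metric N (strips k)"
    and equiv: "coarse_equivalence X X \<phi>"
    and close: "close_maps (mspace X) X (\<phi> \<circ> (f_map k ^^ (k + 1))) ((g_map k ^^ (k + 1)) \<circ> \<phi>)"
  shows False
proof -
  define a b where "a = N (1, 0)" and "b = N (0, 1)"
  have a: "0 < a" and b: "0 \<le> b"
    using is_norm_fst_pos[OF N] is_norm_nonneg[OF N] by (auto simp: a_def b_def)
  have nonneg: "0 \<le> N x" for x by (rule is_norm_nonneg[OF N])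
  have mX: "mspace X = strips k" and dX: "mdist X = (\<lambda>x y. N (x - y))"
    using N by (simp_all add: X)
  from equiv obtain \<psi> where \<psi>: "controlled X X \<psi>" "close_maps (mspace X) X (\<psi> \<circ> \<phi>) id"
    and \<phi>: "controlled X X \<phi>"
    by (auto simp: coarse_equivalence_def coarse_inverse_def)
  have \<phi>_in: "\<phi> x \<in> strips k" if "x \<in> strips k" for x
    using \<phi> that by (auto simp: controlled_def mX)
  obtain C where C: "\<And>x. x \<in> strips k \<Longrightarrow> N (\<psi> (\<phi> x) - x) \<le> C"
    using \<psi>(2) by (auto simp: close_maps_def bdd_above_def mX dX)
  obtain E where E: "\<And>x. x \<in> strips k \<Longrightarrow>
      N (\<phi> ((f_map k ^^ (k + 1)) x) - (g_map k ^^ (k + 1)) (\<phi> x)) \<le> E"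
    using close unfolding close_maps_def bdd_above_def mX dX by fastforce
  obtain A B where AB: "0 \<le> A" "0 \<le> B" "\<And>y. y \<in> strips k \<Longrightarrow> N (\<psi> y) \<le> A * N y + B"
    using controlled_strips_affine_bound[OF N \<psi>(1)[unfolded X]] by metis
  define p where "p = (\<lambda>n. (2 ^ ((k + 1) * n) :: real, real k))"
  have p_in: "p n \<in> strips k" for n by (auto simp: p_def strips_iff)
  have p_Suc: "(f_map k ^^ (k + 1)) (p n) = p (Suc n)" for n
    unfolding p_def by (simp only: f_map_funpow_top) (simp add: power_add algebra_simps)
  have E0: "0 \<le> E" using E[OF p_in[of 0]] nonneg order_trans by blast
  have g_bound: "N ((g_map k ^^ (k + 1)) y) \<le> 2 ^ k * N y + 2 ^ k * (real k * b)"
    if y: "y \<in> strips k" for y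
  proof -
    have "(g_map k ^^ (k + 1)) y = 2 ^ k *\<^sub>R y + (0, (1 - 2 ^ k) * snd y)"
      unfolding g_map_funpow_Suc_k[OF y] by (simp add: prod_eq_iff algebra_simps)
    then have "N ((g_map k ^^ (k + 1)) y) \<le> N (2 ^ k *\<^sub>R y) + N (0, (1 - 2 ^ k) * snd y)"
      by (simp only: is_norm_triangle[OF N])
    also have "N (2 ^ k *\<^sub>R y) = 2 ^ k * N y"
      using is_norm_scale[OF N, of "2 ^ k" y] by simp
    also have "N (0, (1 - 2 ^ k) * snd y) = \<bar>1 - 2 ^ k\<bar> * (\<bar>snd y\<bar> * b)"
      using is_norm_snd_axis[OF N, of "(1 - 2 ^ k) * snd y"] by (simp add: abs_mult b_def)
    also have "\<dots> \<le> 2 ^ k * (real k * b)"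
    proof (intro mult_mono)
      show "\<bar>snd y\<bar> \<le> real k" using y by (auto elim: strips_cases)
      have "(1::real) \<le> 2 ^ k" by simp
      then show "\<bar>1 - 2 ^ k\<bar> \<le> (2 ^ k :: real)" by linarith
    qed (use b in auto)
    finally show ?thesis by simp
  qed
  define F where "F = 2 ^ k * (real k * b) + E"
  have F: "0 \<le> F" using b E0 by (simp add: F_def)
  \<comment> \<open>Adding \<open>F\<close> absorbs the additive error of each step, because \<open>2 * F \<le> 2 ^ k * F\<close>.\<close>
  have growth: "N (\<phi> (p n)) + F \<le> 2 ^ (k * n) * (N (\<phi> (p 0)) + F)" for n
  proof (induction n)
    case (Suc n)
    have "N (\<phi> (p (Suc n))) \<le> N ((g_map k ^^ (k + 1)) (\<phi> (p n))) + E"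
      using is_norm_triangle_sub[OF N, of "\<phi> (p (Suc n))" "(g_map k ^^ (k + 1)) (\<phi> (p n))"]
        E[OF p_in[of n], unfolded p_Suc] by linarith
    also have "\<dots> \<le> 2 ^ k * N (\<phi> (p n)) + F"
      using g_bound[OF \<phi>_in[OF p_in[of n]]] by (simp add: F_def)
    finally have "N (\<phi> (p (Suc n))) + F \<le> 2 ^ k * N (\<phi> (p n)) + 2 * F" by simp
    also have "2 * F \<le> 2 ^ k * F"
      using k F power_increasing[of 1 k "2::real"] by (intro mult_right_mono) auto
    then have "2 ^ k * N (\<phi> (p n)) + 2 * F \<le> 2 ^ k * (N (\<phi> (p n)) + F)"
      by (simp add: algebra_simps)
    also have "\<dots> \<le> 2 ^ k * (2 ^ (k * n) * (N (\<phi> (p 0)) + F))"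
      by (intro mult_left_mono Suc.IH) simp
    finally show ?case by (simp add: power_add mult.assoc)
  qed simp
  define G where "G = N (\<phi> (p 0)) + F"
  define M where "M = A * G + \<bar>B + C + real k * b\<bar>"
  have bound: "2 ^ n * a \<le> M" for n
  proof -
    have one: "(1::real) \<le> 2 ^ (k * n)" by simp
    have "2 ^ ((k + 1) * n) * a \<le> N (p n) + real k * b"
      using is_norm_ge_fst[OF N, of "2 ^ ((k + 1) * n)" "real k"]
      by (simp add: p_def a_def b_def)
    also have "N (p n) \<le> N (\<psi> (\<phi> (p n))) + C"
      using is_norm_triangle_sub[OF N, of "p n" "\<psi> (\<phi> (p n))"] C[OF p_in[of n]]
        is_norm_diff_commute[OF N, of "p n" "\<psi> (\<phi> (p n))"] by linarith
    also have "N (\<psi> (\<phi> (p n))) \<le> A * N (\<phi> (p n)) + B"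
      by (intro AB \<phi>_in p_in)
    also have "N (\<phi> (p n)) \<le> 2 ^ (k * n) * G"
      using growth[of n] F by (simp add: G_def)
    finally have "2 ^ ((k + 1) * n) * a \<le> A * (2 ^ (k * n) * G) + (B + C + real k * b)"
      using AB(1) by (simp add: mult_left_mono)
    also have "\<dots> \<le> A * (2 ^ (k * n) * G) + 2 ^ (k * n) * \<bar>B + C + real k * b\<bar>"
      using mult_right_mono[OF one, of "\<bar>B + C + real k * b\<bar>"] by simp
    also have "\<dots> = 2 ^ (k * n) * M" by (simp add: M_def algebra_simps)
    finally have "2 ^ (k * n) * (2 ^ n * a) \<le> 2 ^ (k * n) * M"
      by (simp add: power_add algebra_simps)
    then show ?thesis by simp
  qed
  obtain n where "M / a < 2 ^ n" using real_arch_pow[of 2 "M / a"] by auto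
  with bound[of n] a show False by (simp add: divide_less_eq)
qed

theorem theorem2p5:
  fixes k :: nat and N :: "real \<times> real \<Rightarrow> real"
    and X Y :: "(real \<times> real) metric"
  assumes "k \<ge> 1" and "is_norm N"
    and "X = norm_metric N (strips k)" and "Y = norm_metric N (strips k)"
  shows "bij_betw (f_map k) (mspace X) (mspace X) \<and>
         bij_betw (g_map k) (mspace Y) (mspace Y) \<and>
         (\<forall>n\<in>{1..k}. coarsely_conjugate_via X Y (f_map k ^^ n) (g_map k ^^ n) id id) \<and>
         (\<nexists>\<phi>. coarse_equivalence X Y \<phi> \<and>
              close_maps (mspace X) Y (\<phi> \<circ> (f_map k ^^ (k + 1))) ((g_map k ^^ (k + 1)) \<circ> \<phi>)) \<and>
         \<not> coarsely_conjugate X Y (f_map k ^^ (k + 1)) (g_map k ^^ (k + 1))"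
proof -
  have Y: "Y = X" using assms by simp
  have no: "\<nexists>\<phi>. coarse_equivalence X X \<phi> \<and>
      close_maps (mspace X) X (\<phi> \<circ> (f_map k ^^ (k + 1))) ((g_map k ^^ (k + 1)) \<circ> \<phi>)"
    using no_coarse_equivalence[OF assms(1-3)] by blast
  then have "\<not> coarsely_conjugate X X (f_map k ^^ (k + 1)) (g_map k ^^ (k + 1))"
    unfolding coarsely_conjugate_def coarsely_conjugate_via_def by blast
  moreover have "mspace X = strips k" using assms by simp
  moreover have "\<forall>n\<in>{1..k}. coarsely_conjugate_via X X (f_map k ^^ n) (g_map k ^^ n) id id"
    using coarsely_conjugate_via_id[OF assms(1,2) _ assms(3)] by auto
  ultimately show ?thesis
    unfolding Y using no bij_betw_f_map[OF assms(1)] bij_betw_g_map[of k] by auto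
qed

end
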